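(* The complete feather $F$ is contractible.
   Context: The complete feather $F$ is the following topological space. Its underlying set is the set of all finite sequences $s=(s_0,\dots,s_n)$, for some $n\ge 0$, with $s_i\in\mathbb{R}$ and $s_0<s_1<\dots<s_{n-1}\le s_n$ (the last inequality is not strict, all the others are; for $n=0$ there is no condition on $s_0$). It carries the partial order defined by $(s_0,\dots,s_n)<(t_0,\dots,t_m)$ if and only if $n\le m$, $s_i=t_i$ for $i=0,\dots,n-1$, and $s_n<t_n$. $F$ is given the order topology of this partial order, i.e. the topology having as a base the open intervals $\{x\in F: a<x<b\}$ with $a,b\in F$, $a<b$. Contractible means that the identity map is homotopic to a constant map (the homotopy is not required to fix the point to which the space is contracted). *)

theory Defs
  imports "HOL-Analysis.Analysis"
begin

text \<open>A sequence \<open>(s\<^sub>0, \<dots>, s\<^sub>n)\<close> is a list of length \<open>n + 1\<close>. All its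
  consecutive inequalities are strict except possibly the last one, \<open>s\<^sub>n\<^sub>-\<^sub>1 \<le> s\<^sub>n\<close>.\<close>

definition feather_set :: "real list set" where
  "feather_set = {s. s \<noteq> [] \<and>
     (\<forall>i. i + 2 < length s \<longrightarrow> s ! i < s ! (i + 1)) \<and>
     (\<forall>i. i + 2 = length s \<longrightarrow> s ! i \<le> s ! (i + 1))}"

text \<open>Here \<open>length s - 1\<close> is the index \<open>n\<close> of the last entry of \<open>s\<close>. The relation
  is meant for nonempty lists only.\<close>

definition feather_less :: "real list \<Rightarrow> real list \<Rightarrow> bool" where
  "feather_less s t \<longleftrightarrow> length s \<le> length t \<and>
     (\<forall>i < length s - 1. s ! i = t ! i) \<and>
     s ! (length s - 1) < t ! (length s - 1)"

definition feather_interval :: "real list \<Rightarrow> real list \<Rightarrow> real list set" where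
  "feather_interval a b = {x \<in> feather_set. feather_less a x \<and> feather_less x b}"

definition feather :: "real list topology" where
  "feather = topology_generated_by
     {feather_interval a b | a b. a \<in> feather_set \<and> b \<in> feather_set \<and> feather_less a b}"

lemma feather_less_irrefl: "\<not> feather_less s s"
  by (simp add: feather_less_def)

lemma feather_less_trans:
  assumes "s \<noteq> []" "feather_less s t" "feather_less t u"
  shows "feather_less s u"
proof (cases "length s = length t")
  case True
  then show ?thesis using assms unfolding feather_less_def by auto
next
  case False
  then have "length s - 1 < length t - 1"
    using assms by (cases s) (auto simp: feather_less_def)
  then show ?thesis using assms unfolding feather_less_def by auto
qed

lemma feather_below_chain:
  assumes "a \<in> feather_set" "c \<in> feather_set" "feather_less a x" "feather_less c x"
  shows "a = c \<or> feather_less a c \<or> feather_less c a"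
proof -
  have wlog: "a = c \<or> feather_less a c \<or> feather_less c a"
    if F: "a \<in> feather_set" "c \<in> feather_set" "feather_less a x" "feather_less c x"
      and le: "length a \<le> length c" for a c
  proof -
    let ?n = "length a - 1"
    have ne: "a \<noteq> []" "c \<noteq> []" using F by (auto simp: feather_set_def)
    have eq: "\<forall>i < ?n. a ! i = c ! i"
      using F le unfolding feather_less_def by auto
    show ?thesis
    proof (cases "length a = length c")
      case True
      consider "a ! ?n < c ! ?n" | "c ! ?n < a ! ?n" | "a ! ?n = c ! ?n" by linarith
      then show ?thesis
      proof cases
        case 3
        have "a = c"
        proof (rule nth_equalityI)
          fix i assume "i < length a"
          then have "i < ?n \<or> i = ?n" by linarith
          then show "a ! i = c ! i" using eq 3 by auto
        qed (rule True)
        then show ?thesis ..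
      qed (use True eq in \<open>auto simp: feather_less_def\<close>)
    next
      case False
      then have lt: "?n < length c - 1" using le ne by (cases a) auto
      then have "c ! ?n = x ! ?n" using F unfolding feather_less_def by auto
      then have "feather_less a c"
        using F le eq unfolding feather_less_def by auto
      then show ?thesis by blast
    qed
  qed
  show ?thesis
    using wlog[of a c] wlog[of c a] assms by (metis nat_le_linear)
qed

lemma feather_above_directed:
  assumes x: "x \<in> feather_set" and "feather_less x b" "feather_less x d"
  obtains e where "e \<in> feather_set" "feather_less x e"
    "e = b \<or> feather_less e b" "e = d \<or> feather_less e d"
proof -
  let ?n = "length x - 1"
  have ne: "x \<noteq> []" using x by (auto simp: feather_set_def)
  define m where "m = min (b ! ?n) (d ! ?n)"
  define r where "r = (x ! ?n + m) / 2"
  have r: "x ! ?n < r" "r < b ! ?n" "r < d ! ?n"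
    using assms unfolding r_def m_def feather_less_def by auto
  define e where "e = x[?n := r]"
  have len: "length e = length x" by (simp add: e_def)
  have lt: "e ! i = x ! i" if "i < ?n" for i using that by (simp add: e_def)
  have last: "e ! ?n = r" using ne by (simp add: e_def)
  have "e \<in> feather_set"
    unfolding feather_set_def
  proof (intro CollectI conjI allI impI)
    show "e \<noteq> []" using ne by (simp add: e_def)
  next
    fix i assume "i + 2 < length e"
    then show "e ! i < e ! (i + 1)"
      using x lt[of i] lt[of "i + 1"] len by (auto simp: feather_set_def)
  next
    fix i assume i: "i + 2 = length e"
    then have "x ! i \<le> x ! (i + 1)" "i + 1 = ?n"
      using x len by (auto simp: feather_set_def)
    then show "e ! i \<le> e ! (i + 1)"
      using lt[of i] last r by simp
  qed
  moreover have "feather_less x e"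
    using len lt last r by (simp add: feather_less_def)
  moreover have "feather_less e b" "feather_less e d"
    using len lt last r assms by (auto simp: feather_less_def)
  ultimately show thesis using that by blast
qed

lemma feather_below_exists:
  assumes x: "x \<in> feather_set"
  obtains a where "a \<in> feather_set" "feather_less a x"
proof -
  let ?a = "[x ! 0 - 1]"
  have "?a \<in> feather_set" by (simp add: feather_set_def)
  moreover have "feather_less ?a x"
    using x by (cases x) (auto simp: feather_less_def feather_set_def)
  ultimately show thesis using that by blast
qed

lemma feather_above_exists:
  assumes x: "x \<in> feather_set"
  obtains b where "b \<in> feather_set" "feather_less x b"
proof -
  let ?n = "length x - 1"
  let ?b = "x[?n := x ! ?n + 1]"
  have ne: "x \<noteq> []" using x by (auto simp: feather_set_def)
  have "?b \<in> feather_set"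
    unfolding feather_set_def
  proof (intro CollectI conjI allI impI)
    show "?b \<noteq> []" using ne by simp
  next
    fix i assume "i + 2 < length ?b"
    then show "?b ! i < ?b ! (i + 1)"
      using x by (auto simp: feather_set_def)
  next
    fix i assume i: "i + 2 = length ?b"
    then have "x ! i \<le> x ! (i + 1)" "i + 1 = ?n"
      using x by (auto simp: feather_set_def)
    then show "?b ! i \<le> ?b ! (i + 1)"
      using ne by (auto simp: nth_list_update)
  qed
  moreover have "feather_less x ?b"
    using ne by (simp add: feather_less_def)
  ultimately show thesis using that by blast
qed

text \<open>The open intervals are a base of the topology they generate, not just a subbase,
  and they cover the whole set.\<close>

lemma openin_feather_iff:
  "openin feather U \<longleftrightarrow> U \<subseteq> feather_set \<and>
     (\<forall>x\<in>U. \<exists>a\<in>feather_set. \<exists>b\<in>feather_set.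
        feather_less a b \<and> x \<in> feather_interval a b \<and> feather_interval a b \<subseteq> U)"
  (is "_ \<longleftrightarrow> ?P U")
proof
  assume "openin feather U"
  then have "generate_topology_on
      {feather_interval a b | a b. a \<in> feather_set \<and> b \<in> feather_set \<and> feather_less a b} U"
    by (simp add: feather_def openin_topology_generated_by_iff)
  then show "?P U"
  proof induction
    case Empty
    then show ?case by simp
  next
    case (Int U V)
    have "\<exists>a\<in>feather_set. \<exists>b\<in>feather_set.
        feather_less a b \<and> x \<in> feather_interval a b \<and> feather_interval a b \<subseteq> U \<inter> V"
      if x: "x \<in> U \<inter> V" for x
    proof -
      obtain a b where ab: "a \<in> feather_set" "b \<in> feather_set"
        "x \<in> feather_interval a b" "feather_interval a b \<subseteq> U" using Int x by blast
      obtain c d where cd: "c \<in> feather_set" "d \<in> feather_set"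
        "x \<in> feather_interval c d" "feather_interval c d \<subseteq> V" using Int x by blast
      have X: "x \<in> feather_set" "feather_less a x" "feather_less c x"
        "feather_less x b" "feather_less x d"
        using ab cd by (auto simp: feather_interval_def)
      obtain p where p: "p \<in> feather_set" "feather_less p x"
        "p = a \<or> feather_less a p" "p = c \<or> feather_less c p"
        using feather_below_chain[OF ab(1) cd(1) X(2,3)] ab cd X by blast
      obtain q where q: "q \<in> feather_set" "feather_less x q"
        "q = b \<or> feather_less q b" "q = d \<or> feather_less q d"
        using feather_above_directed[OF X(1,4,5)] by blast
      have ne: "y \<noteq> []" if "y \<in> feather_set" for y using that by (simp add: feather_set_def)
      have "feather_less p q" using feather_less_trans[OF ne] p q by blast
      moreover have "feather_interval p q \<subseteq> feather_interval a b \<inter> feather_interval c d"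
        using p q feather_less_trans[OF ne] ab(1) cd(1)
        unfolding feather_interval_def by blast
      moreover have "x \<in> feather_interval p q"
        using X p q by (simp add: feather_interval_def)
      ultimately show ?thesis using p(1) q(1) ab(4) cd(4) by blast
    qed
    then show ?case using Int by blast
  next
    case (UN K)
    then show ?case by (meson Union_iff Union_least Union_upper subset_trans)
  next
    case (Basis s)
    then show ?case by (auto simp: feather_interval_def)
  qed
next
  assume P: "?P U"
  show "openin feather U"
  proof (subst openin_subopen, intro ballI)
    fix x assume "x \<in> U"
    then obtain a b where "a \<in> feather_set" "b \<in> feather_set" "feather_less a b"
      "x \<in> feather_interval a b" "feather_interval a b \<subseteq> U" using P by blast
    moreover from this have "openin feather (feather_interval a b)"
      unfolding feather_def by (intro topology_generated_by_Basis) blast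
    ultimately show "\<exists>T. openin feather T \<and> x \<in> T \<and> T \<subseteq> U" by blast
  qed
qed

lemma topspace_feather: "topspace feather = feather_set"
proof -
  have ne: "y \<noteq> []" if "y \<in> feather_set" for y using that by (simp add: feather_set_def)
  have "\<exists>a\<in>feather_set. \<exists>b\<in>feather_set. feather_less a b \<and>
      x \<in> feather_interval a b \<and> feather_interval a b \<subseteq> feather_set"
    if x: "x \<in> feather_set" for x
  proof -
    obtain a where a: "a \<in> feather_set" "feather_less a x" using feather_below_exists[OF x] .
    obtain b where b: "b \<in> feather_set" "feather_less x b" using feather_above_exists[OF x] .
    have "feather_less a b" using feather_less_trans[OF ne[OF a(1)] a(2) b(2)] .
    then show ?thesis using a b x by (auto simp: feather_interval_def)
  qed
  then have "openin feather feather_set" by (simp add: openin_feather_iff)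
  then show ?thesis
    using openin_feather_iff[of "topspace feather"] openin_subset by fastforce
qed

end

theory Submission
  imports Defs
begin

text \<open>The points below \<open>x\<close> form a chain that the last entry maps isomorphically onto
  \<open>(-\<infinity>, last x)\<close>. Hence every \<open>x\<close> can be pushed down its own chain to height \<open>t\<close>, and the
  resulting point depends continuously on \<open>(x, t)\<close>. Since the first entry is also a continuous
  function of \<open>x\<close>, moving the height from \<open>last x\<close> to \<open>hd x - 1\<close> deforms the identity into
  the map \<open>x \<mapsto> (hd x - 1)\<close>, which factors through \<open>\<real>\<close>. Height \<open>hd x\<close> itself would not
  do: there the chain of \<open>x\<close> passes through \<open>(x\<^sub>0, x\<^sub>0)\<close> instead of \<open>(x\<^sub>0)\<close>.\<close>

definition truncate :: "real list \<Rightarrow> real \<Rightarrow> real list" where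
  "truncate x t = (if t < last x then takeWhile (\<lambda>s. s \<le> t) x @ [t] else x)"

section \<open>Monotonicity of entries, and of the first and last entry as functions\<close>

lemma feather_set_nonempty: "x \<in> feather_set \<Longrightarrow> x \<noteq> []"
  by (simp add: feather_set_def)

lemma singleton_in_feather_set: "[t] \<in> feather_set"
  by (simp add: feather_set_def)

lemma feather_set_strict:
  assumes "x \<in> feather_set" "i < j" "j + 1 < length x"
  shows "x ! i < x ! j"
  using assms(2,3)
proof (induction j)
  case (Suc j)
  then have "x ! j < x ! Suc j"
    using assms(1) by (simp add: feather_set_def)
  with Suc show ?case
    by (cases "i = j") auto
qed simp

lemma feather_set_mono:
  assumes "x \<in> feather_set" "i \<le> j" "j < length x"
  shows "x ! i \<le> x ! j"
\<comment> \<open>Only the step into the final index may be an equality, so it is split off from the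
  strict part.\<close>
proof (cases "i < j \<and> j + 1 = length x")
  case True
  then have "i < j - 1 \<or> i = j - 1" by linarith
  then have "x ! i \<le> x ! (j - 1)"
    using feather_set_strict[OF assms(1), of i "j - 1"] True by auto
  also have "x ! (j - 1) \<le> x ! (j - 1 + 1)"
    using assms(1) True by (auto simp: feather_set_def dest: spec[of _ "j - 1"])
  finally show ?thesis using True by simp
next
  case False
  then show ?thesis
    using feather_set_strict[OF assms(1), of i j] assms(2,3)
    by (cases "i = j") auto
qed

lemma feather_less_last:
  assumes "x \<in> feather_set" "y \<in> feather_set" "feather_less x y"
  shows "last x < last y"
proof -
  have "x \<noteq> []" "y \<noteq> []" using assms feather_set_nonempty by auto
  have "last x < y ! (length x - 1)"
    using assms \<open>x \<noteq> []\<close> by (simp add: feather_less_def last_conv_nth)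
  also have "\<dots> \<le> y ! (length y - 1)"
    using assms \<open>y \<noteq> []\<close> by (intro feather_set_mono) (auto simp: feather_less_def)
  finally show ?thesis
    using \<open>y \<noteq> []\<close> by (simp add: last_conv_nth)
qed

text \<open>If \<open>x\<close> has one entry, the first entry strictly grows; otherwise
  \<open>x\<close> and \<open>y\<close> share it.\<close>

lemma feather_less_hd:
  assumes "x \<in> feather_set" "y \<in> feather_set" "feather_less x y"
  shows "hd x \<le> hd y"
proof -
  have "x \<noteq> []" "y \<noteq> []" using assms feather_set_nonempty by auto
  then have "x ! 0 \<le> y ! 0"
    using assms(3) by (cases "0 < length x - 1") (auto simp: feather_less_def)
  then show ?thesis
    using \<open>x \<noteq> []\<close> \<open>y \<noteq> []\<close> by (simp add: hd_conv_nth)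
qed

lemma feather_set_hd_le_last: "x \<in> feather_set \<Longrightarrow> hd x \<le> last x"
  using feather_set_mono[of x 0 "length x - 1"] feather_set_nonempty[of x]
  by (simp add: hd_conv_nth last_conv_nth)

section \<open>Moving a point up or down\<close>

lemma replace_last:
  assumes "x \<in> feather_set" "last x < r"
  shows "butlast x @ [r] \<in> feather_set" "feather_less x (butlast x @ [r])"
proof -
  have ne: "x \<noteq> []" using assms feather_set_nonempty by auto
  have "x ! i < r" if "i < length x" for i
    using feather_set_mono[of x i "length x - 1"] assms that ne
    by (force simp: last_conv_nth)
  then show "butlast x @ [r] \<in> feather_set"
    using assms(1) ne
    by (auto simp: feather_set_def nth_append nth_butlast less_imp_le)
  show "feather_less x (butlast x @ [r])"
    using assms ne by (auto simp: feather_less_def nth_append nth_butlast last_conv_nth)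
qed

text \<open>The non-strict test in \<open>takeWhile\<close> matters: an entry equal to
  \<open>t\<close> is kept and followed by a second \<open>t\<close>, since dropping it would give a
  point that is not below \<open>x\<close>.\<close>

lemma truncate_below:
  assumes "x \<in> feather_set" "t < last x"
  shows "truncate x t \<in> feather_set" "feather_less (truncate x t) x"
    and "last (truncate x t) = t"
proof -
  define k where "k = length (takeWhile (\<lambda>s. s \<le> t) x)"
  have ne: "x \<noteq> []" using assms feather_set_nonempty by auto
  have eq: "truncate x t = take k x @ [t]"
    using assms by (simp add: truncate_def k_def takeWhile_eq_take[symmetric])
  have "takeWhile (\<lambda>s. s \<le> t) x \<noteq> x"
    using assms(2) last_in_set[OF ne] unfolding takeWhile_eq_all_conv by (meson not_le)
  then have k: "k < length x"
    using takeWhile_eq_take[of "\<lambda>s. s \<le> t" x] unfolding k_def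
    by (metis not_less take_all)
  have above: "t < x ! k"
    using nth_length_takeWhile[of "\<lambda>s. s \<le> t" x] k by (simp add: k_def)
  have below: "x ! i \<le> t" if "i < k" for i
    using that nth_mem[of i "takeWhile (\<lambda>s. s \<le> t) x"] takeWhile_nth[of i "\<lambda>s. s \<le> t" x]
    unfolding k_def by (auto dest: set_takeWhileD)
  show "truncate x t \<in> feather_set"
    using k below feather_set_strict[OF assms(1)]
    by (auto simp: eq feather_set_def nth_append min_def)
  show "feather_less (truncate x t) x"
    using k above by (auto simp: eq feather_less_def nth_append min_def)
  show "last (truncate x t) = t"
    by (simp add: eq)
qed

lemma truncate_in_feather_set: "x \<in> feather_set \<Longrightarrow> truncate x t \<in> feather_set"
  using truncate_below(1) by (cases "t < last x") (auto simp: truncate_def)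

lemma truncate_hd:
  assumes "x \<in> feather_set" "t < hd x"
  shows "truncate x t = [t]"
  using assms feather_set_hd_le_last[OF assms(1)] feather_set_nonempty[OF assms(1)]
  by (cases x) (auto simp: truncate_def)

text \<open>Below a common point the order is a chain, and there \<open>last\<close>, being strictly
  monotone, decides it.\<close>

lemma feather_below_comparable:
  assumes "a \<in> feather_set" "c \<in> feather_set" "feather_less a x" "feather_less c x"
    and "last a < last c"
  shows "feather_less a c"
  using feather_below_chain[OF assms(1-4)] assms feather_less_last by fastforce

text \<open>If \<open>t < last x\<close>, then \<open>a\<close> and the truncation are both compared
  inside the chain below \<open>x\<close>, where heights decide; otherwise the height condition is
  automatic. The two variables \<open>x\<close> and \<open>t\<close> are thereby separated.\<close>

lemma less_truncate_iff:
  assumes "a \<in> feather_set" "x \<in> feather_set"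
  shows "feather_less a (truncate x t) \<longleftrightarrow> feather_less a x \<and> last a < t"
proof (cases "t < last x")
  case True
  note p = truncate_below[OF assms(2) True]
  show ?thesis
    using p feather_below_comparable[OF assms(1) p(1) _ p(2)] feather_less_last[OF assms(1) p(1)]
      feather_less_trans[OF feather_set_nonempty[OF assms(1)] _ p(2)]
    by auto
next
  case False
  then show ?thesis
    using feather_less_last[OF assms] by (auto simp: truncate_def)
qed

lemma feather_dense:
  assumes "a \<in> feather_set" "b \<in> feather_set" "feather_less a b"
  obtains c where "c \<in> feather_set" "feather_less a c" "feather_less c b"
proof -
  have l: "last a < last b" using feather_less_last[OF assms] .
  show thesis
    using that[of "truncate b ((last a + last b) / 2)"] l assms less_truncate_iff[OF assms(1,2)]
      truncate_below[OF assms(2)] by simp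
qed

text \<open>The order branches upwards, so \<open>b\<close> may leave the chain of \<open>x\<close>
  above height \<open>t\<close>. The witness \<open>c\<close> is a point of the common stretch of
  both chains above \<open>t\<close>; in this form the condition is visibly open in \<open>x\<close>
  and \<open>t\<close> jointly.\<close>

lemma truncate_less_iff:
  assumes b: "b \<in> feather_set" and x: "x \<in> feather_set"
  shows "feather_less (truncate x t) b \<longleftrightarrow>
    feather_less x b \<or> (\<exists>c\<in>feather_set. feather_less c b \<and> feather_less c x \<and> t < last c)"
proof (cases "t < last x")
  case True
  note p = truncate_below[OF x True]
  note trans = feather_less_trans[OF feather_set_nonempty]
  show ?thesis
  proof
    assume "feather_less (truncate x t) b"
    then obtain e where e: "e \<in> feather_set" "feather_less (truncate x t) e"
      "e = b \<or> feather_less e b" "e = x \<or> feather_less e x"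
      using feather_above_directed[OF p(1) _ p(2)] by blast
    \<comment> \<open>The point \<open>e\<close> may coincide with \<open>b\<close> or
      \<open>x\<close>; density gives a point strictly below both.\<close>
    obtain c where c: "c \<in> feather_set" "feather_less (truncate x t) c" "feather_less c e"
      using feather_dense[OF p(1) e(1,2)] .
    have "t < last c" using feather_less_last[OF p(1) c(1,2)] p(3) by simp
    then show "feather_less x b \<or>
        (\<exists>c\<in>feather_set. feather_less c b \<and> feather_less c x \<and> t < last c)"
      using c e trans by blast
  next
    assume "feather_less x b \<or>
        (\<exists>c\<in>feather_set. feather_less c b \<and> feather_less c x \<and> t < last c)"
    then show "feather_less (truncate x t) b"
    proof
      assume "feather_less x b"
      then show ?thesis by (rule trans[OF p(1,2)])
    next
      assume "\<exists>c\<in>feather_set. feather_less c b \<and> feather_less c x \<and> t < last c"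
      then obtain c where c: "c \<in> feather_set" "feather_less c b" "feather_less c x" "t < last c"
        by blast
      then have "feather_less (truncate x t) c"
        using p by (intro feather_below_comparable[OF p(1) c(1) p(2)]) auto
      then show ?thesis using c(2) by (rule trans[OF p(1)])
    qed
  qed
next
  case False
  then have "\<not> t < last c" if "c \<in> feather_set" "feather_less c x" for c
    using feather_less_last[OF that(1) x that(2)] by simp
  with False show ?thesis by (auto simp: truncate_def)
qed

section \<open>Open rays and continuity\<close>

lemma openin_feather_greater:
  assumes "a \<in> feather_set"
  shows "openin feather {x \<in> feather_set. feather_less a x}"
  unfolding openin_feather_iff
proof (intro conjI ballI)
  fix x assume x: "x \<in> {x \<in> feather_set. feather_less a x}"
  then obtain b where "b \<in> feather_set" "feather_less x b"
    using feather_above_exists by blast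
  then show "\<exists>a'\<in>feather_set. \<exists>b\<in>feather_set. feather_less a' b \<and> x \<in> feather_interval a' b \<and>
      feather_interval a' b \<subseteq> {x \<in> feather_set. feather_less a x}"
    using x assms feather_less_trans[OF feather_set_nonempty[OF assms]]
    by (intro bexI[of _ a] bexI[of _ b]) (auto simp: feather_interval_def)
qed auto

lemma openin_feather_less:
  assumes "b \<in> feather_set"
  shows "openin feather {x \<in> feather_set. feather_less x b}"
  unfolding openin_feather_iff
proof (intro conjI ballI)
  fix x assume x: "x \<in> {x \<in> feather_set. feather_less x b}"
  then obtain a where a: "a \<in> feather_set" "feather_less a x"
    using feather_below_exists by blast
  then show "\<exists>a\<in>feather_set. \<exists>b'\<in>feather_set. feather_less a b' \<and> x \<in> feather_interval a b' \<and>
      feather_interval a b' \<subseteq> {x \<in> feather_set. feather_less x b}"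
    using x a assms feather_less_trans[OF feather_set_nonempty[OF a(1)], of x b]
    by (intro bexI[of _ a] bexI[of _ b]) (auto simp: feather_interval_def)
qed auto

text \<open>Each basic interval is the intersection of two rays, so preimages of rays
  suffice.\<close>

lemma continuous_map_into_feather:
  assumes "f \<in> topspace X \<rightarrow> feather_set"
    and "\<And>a. a \<in> feather_set \<Longrightarrow> openin X {z \<in> topspace X. feather_less a (f z)}"
    and "\<And>b. b \<in> feather_set \<Longrightarrow> openin X {z \<in> topspace X. feather_less (f z) b}"
  shows "continuous_map X feather f"
  unfolding feather_def
proof (rule continuous_on_generated_topo)
  fix U
  assume "U \<in> {feather_interval a b |a b.
      a \<in> feather_set \<and> b \<in> feather_set \<and> feather_less a b}"
  then obtain a b where ab: "a \<in> feather_set" "b \<in> feather_set" and U: "U = feather_interval a b"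
    by blast
  have "f -` U \<inter> topspace X =
      {z \<in> topspace X. feather_less a (f z)} \<inter> {z \<in> topspace X. feather_less (f z) b}"
    using assms(1) by (auto simp: U feather_interval_def)
  then show "openin X (f -` U \<inter> topspace X)"
    using assms(2,3) ab by auto
next
  show "f ` topspace X \<subseteq>
     \<Union> {feather_interval a b |a b. a \<in> feather_set \<and> b \<in> feather_set \<and> feather_less a b}"
    using assms(1) topspace_feather
    by (auto simp: feather_def topology_generated_by_topspace)
qed

lemma continuous_map_last: "continuous_map feather euclideanreal last"
  unfolding continuous_map_upper_lower_semicontinuous_lt topspace_feather
proof (intro conjI allI)
  fix r
  \<comment> \<open>The bound \<open>b\<close> of height exactly \<open>r\<close> arises by
    replacing the last entry of \<open>x\<close> with \<open>r\<close>; dually, truncation at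
    \<open>r\<close> supplies \<open>a\<close> below.\<close>
  have "{x \<in> feather_set. last x < r} =
      (\<Union>b\<in>{b \<in> feather_set. last b = r}. {x \<in> feather_set. feather_less x b})"
    using replace_last[of _ r] feather_less_last by force
  also have "openin feather \<dots>"
    by (auto intro: openin_feather_less)
  finally show "openin feather {x \<in> feather_set. last x < r}" .
  have "{x \<in> feather_set. r < last x} =
      (\<Union>a\<in>{a \<in> feather_set. last a = r}. {x \<in> feather_set. feather_less a x})"
    using truncate_below[of _ r] feather_less_last by force
  also have "openin feather \<dots>"
    by (auto intro: openin_feather_greater)
  finally show "openin feather {x \<in> feather_set. r < last x}" .
qed

text \<open>Raising the last entry leaves the first one alone unless they are the same entry; then
  it is raised only halfway to \<open>r\<close>.\<close>

lemma feather_above_exists_hd: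
  assumes "x \<in> feather_set" "hd x < r"
  obtains b where "b \<in> feather_set" "feather_less x b" "hd b < r"
proof (cases "butlast x = []")
  case True
  then have "last x = hd x"
    using feather_set_nonempty[OF assms(1)] by (cases x) (auto split: if_splits)
  then show thesis
    using replace_last[OF assms(1), of "(hd x + r) / 2"] that assms True by fastforce
next
  case False
  then have "hd (butlast x @ [last x + 1]) = hd x"
    by (cases x) (auto split: if_splits)
  then show thesis
    using replace_last[OF assms(1), of "last x + 1"] that assms by fastforce
qed

lemma continuous_map_hd: "continuous_map feather euclideanreal hd"
  unfolding continuous_map_upper_lower_semicontinuous_lt topspace_feather
proof (intro conjI allI)
  fix r
  have "{x \<in> feather_set. hd x < r} =
      (\<Union>b\<in>{b \<in> feather_set. hd b < r}. {x \<in> feather_set. feather_less x b})"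
    using feather_less_hd by (force elim: feather_above_exists_hd)
  also have "openin feather \<dots>"
    by (auto intro: openin_feather_less)
  finally show "openin feather {x \<in> feather_set. hd x < r}" .
  have "{x \<in> feather_set. r < hd x} = {x \<in> feather_set. feather_less [r] x}"
    using feather_set_nonempty
    by (auto simp: feather_less_def hd_conv_nth Suc_le_eq)
  then show "openin feather {x \<in> feather_set. r < hd x}"
    by (simp add: openin_feather_greater singleton_in_feather_set)
qed

text \<open>The preimage of an upper ray is one open rectangle, that of a lower ray a union of open
  rectangles.\<close>

lemma continuous_map_truncate:
  "continuous_map (prod_topology feather euclideanreal) feather (\<lambda>(x, t). truncate x t)"
proof (rule continuous_map_into_feather)
  show "(\<lambda>(x, t). truncate x t) \<in> topspace (prod_topology feather euclideanreal) \<rightarrow> feather_set"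
    by (auto simp: topspace_feather truncate_in_feather_set)
next
  fix a assume a: "a \<in> feather_set"
  have "{z \<in> topspace (prod_topology feather euclideanreal).
        feather_less a (case z of (x, t) \<Rightarrow> truncate x t)} =
      {x \<in> feather_set. feather_less a x} \<times> {last a <..}"
    using less_truncate_iff[OF a] by (auto simp: topspace_feather)
  then show "openin (prod_topology feather euclideanreal)
      {z \<in> topspace (prod_topology feather euclideanreal).
        feather_less a (case z of (x, t) \<Rightarrow> truncate x t)}"
    using a by (simp add: openin_prod_Times_iff openin_feather_greater)
next
  fix b assume b: "b \<in> feather_set"
  have "{z \<in> topspace (prod_topology feather euclideanreal).
        feather_less (case z of (x, t) \<Rightarrow> truncate x t) b} =
      {x \<in> feather_set. feather_less x b} \<times> UNIV \<union>
      (\<Union>c\<in>{c \<in> feather_set. feather_less c b}.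
        {x \<in> feather_set. feather_less c x} \<times> {..<last c})"
    using truncate_less_iff[OF b] by (auto simp: topspace_feather)
  moreover have "openin (prod_topology feather euclideanreal) \<dots>"
    using b by (intro openin_Un openin_Union)
      (auto simp: openin_prod_Times_iff openin_feather_greater openin_feather_less)
  ultimately show "openin (prod_topology feather euclideanreal)
      {z \<in> topspace (prod_topology feather euclideanreal).
        feather_less (case z of (x, t) \<Rightarrow> truncate x t) b}"
    by simp
qed

lemma continuous_map_singleton: "continuous_map euclideanreal feather (\<lambda>t. [t])"
proof (rule continuous_map_into_feather)
  fix a assume "a \<in> feather_set"
  \<comment> \<open>A sequence with several entries lies below no one-entry sequence.\<close>
  then have "{t. feather_less a [t]} = (if length a = 1 then {hd a <..} else {})"
    using feather_set_nonempty[of a]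
    by (auto simp: feather_less_def hd_conv_nth le_Suc_eq)
  then show "openin euclideanreal {t \<in> topspace euclideanreal. feather_less a [t]}"
    by simp
next
  fix b assume "b \<in> feather_set"
  then have "{t. feather_less [t] b} = {..<hd b}"
    using feather_set_nonempty[of b]
    by (auto simp: feather_less_def hd_conv_nth Suc_le_eq)
  then show "openin euclideanreal {t \<in> topspace euclideanreal. feather_less [t] b}"
    by simp
qed (simp add: singleton_in_feather_set)

theorem lemma2p2:
  shows "contractible_space feather"
proof -
  let ?I = "top_of_set {0..1::real}"
  \<comment> \<open>The height runs linearly from \<open>last x\<close>, where truncation changes
    nothing, to \<open>hd x - 1\<close>, where only \<open>[hd x - 1]\<close> remains.\<close>
  let ?height = "\<lambda>(\<tau>, x). last x - \<tau> * (last x - hd x + 1)"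
  let ?h = "\<lambda>z. truncate (snd z) (?height z)"
  have [continuous_intros]: "continuous_map (prod_topology ?I feather) euclideanreal fst"
    using continuous_map_fst[of ?I feather] continuous_map_into_fulltopology by blast
  have l: "continuous_map (prod_topology ?I feather) euclideanreal (\<lambda>z. last (snd z))"
    and h: "continuous_map (prod_topology ?I feather) euclideanreal (\<lambda>z. hd (snd z))"
    using continuous_map_compose[OF continuous_map_snd continuous_map_last]
      continuous_map_compose[OF continuous_map_snd continuous_map_hd]
    by (auto simp: o_def)
  have "continuous_map (prod_topology ?I feather) euclideanreal ?height"
    unfolding case_prod_unfold by (intro continuous_intros l h)
  then have "continuous_map (prod_topology ?I feather) (prod_topology feather euclideanreal)
      (\<lambda>z. (snd z, ?height z))"
    by (intro continuous_map_pairedI continuous_map_snd)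
  then have "continuous_map (prod_topology ?I feather) feather ?h"
    using continuous_map_compose[OF _ continuous_map_truncate] by (fastforce simp: o_def)
  then have "homotopic_with (\<lambda>_. True) feather feather
      (\<lambda>x. ?h (0, x)) (\<lambda>x. ?h (1, x))"
    unfolding homotopic_with_def by (intro exI[of _ ?h]) auto
  then have *: "homotopic_with (\<lambda>_. True) feather feather id ((\<lambda>t. [t]) \<circ> (\<lambda>x. hd x - 1))"
    by (rule homotopic_with_eq)
      (auto simp: topspace_feather truncate_hd, simp add: truncate_def)
  have "continuous_map feather euclideanreal (\<lambda>x. hd x - 1)"
    by (intro continuous_intros continuous_map_hd)
  moreover have "contractible_space euclideanreal"
    using contractible_space_top_of_set[of "UNIV :: real set"] by simp
  \<comment> \<open>The end map factors through the contractible real line, hence is homotopic to a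
    constant.\<close>
  ultimately obtain c where
    "homotopic_with (\<lambda>_. True) feather feather ((\<lambda>t. [t]) \<circ> (\<lambda>x. hd x - 1)) (\<lambda>x. c)"
    using nullhomotopic_through_contractible_space[OF _ continuous_map_singleton] by metis
  then show ?thesis
    using * homotopic_with_trans unfolding contractible_space_def by blast
qed

end
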